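(* Let $Z$ be a Cayley graph for $\mathbb{Z}_2^n$ and let $\rho$ be a retraction of $Z$ onto an induced subgraph $X^\bullet$ of $Z$ that is isomorphic to the core of $Z$ and contains the vertex $0$. Let $X$ be an orbital graph of $X^\bullet$ (so $V(X)=V(X^\bullet)\subseteq\mathbb{Z}_2^n$) and let $a_1,\dots,a_d$ be the neighbours of $0$ in $X$. Let $Y=\mathrm{Cay}(\langle a_1,\dots,a_d\rangle,\{a_1,\dots,a_d\})$, where $\langle a_1,\dots,a_d\rangle$ is the subgroup of $\mathbb{Z}_2^n$ generated by $a_1,\dots,a_d$. Then the restriction $\rho\restriction_{V(Y)}$ is a covering map from $Y$ to the connected component of $X$ containing $0$. Moreover, this connected component is covered by the $d$-cube $Q_d$ (i.e. there is a covering map from $Q_d$ to it).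
   Context: All graphs are finite, undirected and simple. For an elementary abelian $2$-group $\Gamma$ and $C\subseteq\Gamma\setminus\{0\}$, $\mathrm{Cay}(\Gamma,C)$ has vertex set $\Gamma$ and $a\sim b$ iff $a+b\in C$. A graph is a core if all its endomorphisms are bijective; the core of $Z$ is the unique (up to isomorphism) core homomorphically equivalent to $Z$. A retraction of $Z$ onto an induced subgraph $X^\bullet$ is an endomorphism of $Z$ with image $X^\bullet$ that is the identity on $V(X^\bullet)$. The orbitals of $\operatorname{Aut}(X^\bullet)$ are its orbits on $V(X^\bullet)\times V(X^\bullet)$. An orbital graph of $X^\bullet$ is a graph with vertex set $V(X^\bullet)$ whose set of arcs (ordered pairs of adjacent vertices) is a symmetric union of non-diagonal orbitals of $\operatorname{Aut}(X^\bullet)$. A covering map from $G$ to $H$ is a surjective homomorphism $\varphi$ such that for every $u\in V(G)$, $\varphi$ restricts to a bijection from the neighbourhood of $u$ to the neighbourhood of $\varphi(u)$. $Q_d=\mathrm{Cay}(\mathbb{Z}_2^d,\{e_1,\dots,e_d\})$, with $e_i$ the standard basis vectors. *)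

theory Defs
  imports
    "Graph_Theory.Digraph_Isomorphism"
    "Graph_Theory.Pair_Digraph"
    "HOL-Algebra.Product_Groups"
begin

text \<open>
  A finite simple graph is a \<^locale>\<open>pair_graph\<close>: \<^const>\<open>parcs\<close> holds the ordered pairs of adjacent
  vertices, and is irreflexive and symmetric. Maps between graphs are total functions of which only
  the values on the vertex set matter.
\<close>

definition neighbourhood :: "'a pair_pre_digraph \<Rightarrow> 'a \<Rightarrow> 'a set" where
  "neighbourhood G u = {v. (u, v) \<in> parcs G}"

definition component :: "'a pair_pre_digraph \<Rightarrow> 'a \<Rightarrow> 'a pair_pre_digraph" where
  "component G u =
     (let S = {v. u \<rightarrow>\<^sup>*\<^bsub>with_proj G\<^esub> v} in \<lparr>pverts = S, parcs = parcs G \<inter> S \<times> S\<rparr>)"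

definition graph_hom :: "'a pair_pre_digraph \<Rightarrow> 'b pair_pre_digraph \<Rightarrow> ('a \<Rightarrow> 'b) \<Rightarrow> bool" where
  "graph_hom G H f \<longleftrightarrow>
     f \<in> pverts G \<rightarrow> pverts H \<and> (\<forall>u v. (u, v) \<in> parcs G \<longrightarrow> (f u, f v) \<in> parcs H)"

definition is_core :: "'a pair_pre_digraph \<Rightarrow> bool" where
  "is_core G \<longleftrightarrow> pair_graph G \<and> (\<forall>f. graph_hom G G f \<longrightarrow> bij_betw f (pverts G) (pverts G))"

definition hom_equivalent :: "'a pair_pre_digraph \<Rightarrow> 'b pair_pre_digraph \<Rightarrow> bool" where
  "hom_equivalent G H \<longleftrightarrow> (\<exists>f. graph_hom G H f) \<and> (\<exists>g. graph_hom H G g)"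

text \<open>The core of a graph is determined only up to isomorphism, so it is given by a predicate.\<close>

definition core_of :: "'a pair_pre_digraph \<Rightarrow> 'b pair_pre_digraph \<Rightarrow> bool" where
  "core_of K G \<longleftrightarrow> is_core K \<and> hom_equivalent K G"

definition retraction_onto ::
    "'a pair_pre_digraph \<Rightarrow> 'a pair_pre_digraph \<Rightarrow> ('a \<Rightarrow> 'a) \<Rightarrow> bool" where
  "retraction_onto Z X \<rho> \<longleftrightarrow>
     induced_subgraph (with_proj X) (with_proj Z) \<and> graph_hom Z Z \<rho> \<and>
     \<rho> ` pverts Z = pverts X \<and> (\<forall>x \<in> pverts X. \<rho> x = x)"

definition automorphisms :: "'a pair_pre_digraph \<Rightarrow> ('a \<Rightarrow> 'a) set" where
  "automorphisms G =
     {iso_verts f | f. pre_digraph.digraph_isomorphism (with_proj G) f \<and>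
                       app_iso f (with_proj G) = with_proj G}"

definition orbitals :: "'a pair_pre_digraph \<Rightarrow> ('a \<times> 'a) set set" where
  "orbitals G = {{(g u, g v) | g. g \<in> automorphisms G} | u v. u \<in> pverts G \<and> v \<in> pverts G}"

definition orbital_graph :: "'a pair_pre_digraph \<Rightarrow> 'a pair_pre_digraph \<Rightarrow> bool" where
  "orbital_graph G X \<longleftrightarrow>
     pverts X = pverts G \<and> sym (parcs X) \<and>
     (\<exists>\<O> \<subseteq> {R \<in> orbitals G. \<not> R \<subseteq> Id}. parcs X = \<Union>\<O>)"

definition covering_map :: "'a pair_pre_digraph \<Rightarrow> 'b pair_pre_digraph \<Rightarrow> ('a \<Rightarrow> 'b) \<Rightarrow> bool" where
  "covering_map G H \<phi> \<longleftrightarrow>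
     graph_hom G H \<phi> \<and> \<phi> ` pverts G = pverts H \<and>
     (\<forall>u \<in> pverts G. bij_betw \<phi> (neighbourhood G u) (neighbourhood H (\<phi> u)))"

text \<open>
  The elementary abelian 2-groups below are written multiplicatively, as in HOL-Algebra: the group
  operation is addition in $\mathbb{Z}_2^n$ and the unit is the zero vector. \<open>Cay\<close> is meant for
  such groups only; inverses, being trivial there, are omitted.
\<close>

definition Cay :: "('a, 'm) monoid_scheme \<Rightarrow> 'a set \<Rightarrow> 'a pair_pre_digraph" where
  "Cay \<Gamma> C = \<lparr>pverts = carrier \<Gamma>,
              parcs = {(a, b). a \<in> carrier \<Gamma> \<and> b \<in> carrier \<Gamma> \<and> a \<otimes>\<^bsub>\<Gamma>\<^esub> b \<in> C}\<rparr>"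

definition Z2pow :: "nat \<Rightarrow> (nat \<Rightarrow> int) monoid" where
  "Z2pow n = product_group {..<n} (\<lambda>_. integer_mod_group 2)"

definition unit_vec :: "nat \<Rightarrow> nat \<Rightarrow> nat \<Rightarrow> int" where
  "unit_vec d i = (\<lambda>j\<in>{..<d}. if j = i then 1 else 0)"

definition cube :: "nat \<Rightarrow> (nat \<Rightarrow> int) pair_pre_digraph" where
  "cube d = Cay (Z2pow d) (unit_vec d ` {..<d})"

lemma comm_group_Z2pow: "comm_group (Z2pow n)"
proof (rule group.group_comm_groupI)
  show "group (Z2pow n)"
    unfolding Z2pow_def by simp
qed (simp add: Z2pow_def fun_eq_iff mult_integer_mod_group add.commute)

lemma Z2pow_square: "a \<in> carrier (Z2pow n) \<Longrightarrow> a \<otimes>\<^bsub>Z2pow n\<^esub> a = \<one>\<^bsub>Z2pow n\<^esub>"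
  by (simp add: Z2pow_def fun_eq_iff mult_integer_mod_group restrict_def)

lemma finite_Z2pow: "finite (carrier (Z2pow n))"
  unfolding Z2pow_def by (auto simp: carrier_integer_mod_group intro!: finite_PiE)

lemma pair_graph_Cay:
  assumes "comm_group \<Gamma>" and fin: "finite (carrier \<Gamma>)"
    and sq: "\<And>a. a \<in> carrier \<Gamma> \<Longrightarrow> a \<otimes>\<^bsub>\<Gamma>\<^esub> a = \<one>\<^bsub>\<Gamma>\<^esub>"
    and C: "C \<subseteq> carrier \<Gamma> - {\<one>\<^bsub>\<Gamma>\<^esub>}"
  shows "pair_graph (Cay \<Gamma> C)"
proof -
  interpret comm_group \<Gamma> by fact
  have "finite (parcs (Cay \<Gamma> C))"
    by (rule finite_subset[of _ "carrier \<Gamma> \<times> carrier \<Gamma>"]) (auto simp: Cay_def fin)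
  moreover have "symmetric (with_proj (Cay \<Gamma> C))"
    by (auto simp: symmetric_def sym_def Cay_def m_comm)
  ultimately show ?thesis
    using fin sq C by unfold_locales (auto simp: Cay_def)
qed

lemma automorphisms_iff:
  assumes "pair_wf_digraph G"
  shows "g \<in> automorphisms G \<longleftrightarrow>
    bij_betw g (pverts G) (pverts G) \<and>
    (\<forall>u \<in> pverts G. \<forall>v \<in> pverts G. (g u, g v) \<in> parcs G \<longleftrightarrow> (u, v) \<in> parcs G)"
    (is "_ \<longleftrightarrow> ?R")
proof -
  interpret pair_wf_digraph G by fact
  have wf: "wf_digraph (with_proj G)" by unfold_locales
  show ?thesis
  proof
    assume "g \<in> automorphisms G"
    then obtain f where g: "g = iso_verts f" and f: "digraph_isomorphism f"
      and app: "app_iso f (with_proj G) = with_proj G"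
      by (auto simp: automorphisms_def)
    from app have V: "g ` pverts G = pverts G" and E: "iso_arcs f ` parcs G = parcs G"
      and hd: "iso_head f = snd" and tl: "iso_tail f = fst"
      by (auto simp: app_iso_def with_proj_def g)
    from f have inj: "inj_on g (pverts G)"
      and fa: "\<And>e. e \<in> parcs G \<Longrightarrow> iso_arcs f e = (g (fst e), g (snd e))"
      by (auto simp: digraph_isomorphism_def g hd tl prod_eq_iff)
    have "(g u, g v) \<in> parcs G \<longleftrightarrow> (u, v) \<in> parcs G" if "u \<in> pverts G" "v \<in> pverts G" for u v
    proof
      assume "(u, v) \<in> parcs G"
      then show "(g u, g v) \<in> parcs G" using fa E by force
    next
      assume "(g u, g v) \<in> parcs G"
      then obtain e where "e \<in> parcs G" "iso_arcs f e = (g u, g v)" using E by (metis imageE)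
      then have "g (fst e) = g u" "g (snd e) = g v"
        using fa by auto
      then have "fst e = u" "snd e = v"
        using \<open>e \<in> parcs G\<close> that inj arc_fst_in_verts arc_snd_in_verts by (auto dest: inj_onD)
      then have "e = (u, v)" by (simp add: prod_eq_iff)
      then show "(u, v) \<in> parcs G" using \<open>e \<in> parcs G\<close> by simp
    qed
    then show ?R using V inj by (auto simp: bij_betw_def)
  next
    assume R: ?R
    define f :: "('a, 'a \<times> 'a, 'a, 'a \<times> 'a) digraph_isomorphism" where
      "f = \<lparr>iso_verts = g, iso_arcs = map_prod g g, iso_head = snd, iso_tail = fst\<rparr>"
    have inj: "inj_on g (pverts G)" and V: "g ` pverts G = pverts G"
      using R by (auto simp: bij_betw_def)
    have sub: "parcs G \<subseteq> pverts G \<times> pverts G"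
      using arc_fst_in_verts arc_snd_in_verts by fastforce
    have "inj_on (map_prod g g) (parcs G)"
      using map_prod_inj_on[OF inj inj] sub by (rule inj_on_subset)
    moreover have "map_prod g g ` parcs G = parcs G"
    proof
      show "map_prod g g ` parcs G \<subseteq> parcs G" using R sub by auto
      show "parcs G \<subseteq> map_prod g g ` parcs G"
      proof
        fix e assume e: "e \<in> parcs G"
        then have "fst e \<in> g ` pverts G" "snd e \<in> g ` pverts G"
          unfolding V using arc_fst_in_verts arc_snd_in_verts by auto
        then obtain u v where uv: "u \<in> pverts G" "v \<in> pverts G" "e = (g u, g v)"
          by (auto simp: prod_eq_iff)
        then have "(u, v) \<in> parcs G" using R e by auto
        then show "e \<in> map_prod g g ` parcs G" using uv by force
      qed
    qed
    ultimately have "digraph_isomorphism f" "app_iso f (with_proj G) = with_proj G"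
      using inj V wf by (auto simp: pre_digraph.digraph_isomorphism_def app_iso_def f_def with_proj_def)
    moreover have "g = iso_verts f" by (simp add: f_def)
    ultimately show "g \<in> automorphisms G" unfolding automorphisms_def by blast
  qed
qed

end

theory Submission
  imports Defs "HOL-Algebra.FiniteProduct"
begin

text \<open>
  Write \<open>\<Gamma>\<close> for \<open>\<int>\<^sub>2\<^sup>n\<close>. Every translation \<open>x \<mapsto> u + x\<close> of \<open>\<Gamma>\<close> is an automorphism of the Cayley graph \<open>Z\<close>, so
  following it by the retraction \<open>\<rho>\<close> gives an endomorphism \<open>x \<mapsto> \<rho> (u + x)\<close> of the retract
  \<open>X\<^sup>\<bullet>\<close>. The retract is a core, hence this endomorphism is an automorphism of \<open>X\<^sup>\<bullet>\<close>
  (\<open>retract_translate_automorphism\<close>), and therefore also an automorphism of the orbital graph \<open>X\<close>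
  (\<open>automorphism_orbital_graph\<close>). It takes \<open>0\<close> to \<open>\<rho> u\<close>, so it takes the neighbours
  \<open>a\<^sub>i\<close> of \<open>0\<close> in \<open>X\<close> bijectively to the neighbours of \<open>\<rho> u\<close> in \<open>X\<close>. But the image of
  \<open>a\<^sub>i\<close> is \<open>\<rho> (u + a\<^sub>i)\<close>, and the vertices \<open>u + a\<^sub>i\<close> are the neighbours of \<open>u\<close> in \<open>Y\<close>. Thus
  \<open>\<rho>\<close> is a local bijection from \<open>Y\<close> to \<open>X\<close>.

  A local bijection on a connected graph is a covering of the component that it meets
  (\<open>covering_map_component\<close>), because paths in the target lift; and \<open>Y\<close> is connected because the
  \<open>a\<^sub>i\<close> generate its vertex group. This is the first claim.

  For the second claim, the linear map \<open>x \<mapsto> \<Sum>\<^sub>i x\<^sub>i a\<^sub>i\<close> from \<open>\<int>\<^sub>2\<^sup>d\<close> onto \<open>\<langle>a\<^sub>1, \<dots>, a\<^sub>d\<rangle>\<close> takes the standard basis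
  bijectively to the connection set of \<open>Y\<close>, so it is a covering of \<open>Y\<close> by the cube
  (\<open>covering_map_hom_Cay\<close>), and coverings compose.
\<close>

section \<open>Covering maps\<close>

lemma pair_wf_digraphI:
  "parcs G \<subseteq> pverts G \<times> pverts G \<Longrightarrow> pair_wf_digraph G"
  by unfold_locales auto

lemma pair_wf_digraph_parcsD:
  assumes "pair_wf_digraph G" and "(u, v) \<in> parcs G"
  shows "u \<in> pverts G" and "v \<in> pverts G"
  using pair_wf_digraph.arc_fst_in_verts[OF assms] pair_wf_digraph.arc_snd_in_verts[OF assms]
  by simp_all

lemma reachable_refl_pair:
  "v \<in> pverts G \<Longrightarrow> v \<rightarrow>\<^sup>*\<^bsub>with_proj G\<^esub> v"
  by (auto simp: reachable_def)

lemma reachable_step_pair: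
  assumes "pair_wf_digraph G" and "u \<rightarrow>\<^sup>*\<^bsub>with_proj G\<^esub> v" and "(v, w) \<in> parcs G"
  shows "u \<rightarrow>\<^sup>*\<^bsub>with_proj G\<^esub> w"
  using assms(2,3) pair_wf_digraph_parcsD[OF assms(1,3)]
  by (auto simp: reachable_def intro: rtrancl_on_into_rtrancl_on)

lemma covering_map_compose:
  assumes "covering_map G H f" and "covering_map H K g"
  shows "covering_map G K (g \<circ> f)"
proof -
  have f: "graph_hom G H f" "f ` pverts G = pverts H"
    and loc_f: "\<And>u. u \<in> pverts G \<Longrightarrow> bij_betw f (neighbourhood G u) (neighbourhood H (f u))"
    using assms(1) by (auto simp: covering_map_def)
  have g: "graph_hom H K g" "g ` pverts H = pverts K"
    and loc_g: "\<And>u. u \<in> pverts H \<Longrightarrow> bij_betw g (neighbourhood H u) (neighbourhood K (g u))"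
    using assms(2) by (auto simp: covering_map_def)
  have "graph_hom G K (g \<circ> f)"
    using f(1) g(1) by (fastforce simp: graph_hom_def)
  moreover have "(g \<circ> f) ` pverts G = pverts K"
    unfolding image_comp[symmetric] f(2) g(2) ..
  moreover have "bij_betw (g \<circ> f) (neighbourhood G u) (neighbourhood K ((g \<circ> f) u))"
    if "u \<in> pverts G" for u
    using bij_betw_trans[OF loc_f[OF that] loc_g[of "f u"]] f(2) that by auto
  ultimately show ?thesis
    by (simp add: covering_map_def)
qed

lemma covering_map_restrict:
  assumes wf: "pair_wf_digraph G" and cov: "covering_map G H \<phi>"
  shows "covering_map G H (restrict \<phi> (pverts G))"
proof -
  have "bij_betw (restrict \<phi> (pverts G)) (neighbourhood G u) (neighbourhood H (\<phi> u))"
    if "u \<in> pverts G" for u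
  proof (rule bij_betw_cong[THEN iffD1])
    show "bij_betw \<phi> (neighbourhood G u) (neighbourhood H (\<phi> u))"
      using cov that by (simp add: covering_map_def)
  qed (auto simp: neighbourhood_def dest: pair_wf_digraph_parcsD[OF wf])
  moreover have "graph_hom G H (restrict \<phi> (pverts G))"
    using cov by (auto simp: covering_map_def graph_hom_def dest: pair_wf_digraph_parcsD[OF wf])
  ultimately show ?thesis
    using cov by (auto simp: covering_map_def)
qed

text \<open>
  Surjectivity comes for free: a local bijection lifts every arc that starts at an image vertex, so
  its image is closed under taking neighbours. Connectedness of the source in turn confines the
  image to a single component.
\<close>

lemma covering_map_component:
  assumes wfG: "pair_wf_digraph G" and wfH: "pair_wf_digraph H"
    and hom: "graph_hom G H \<phi>"
    and loc: "\<And>u. u \<in> pverts G \<Longrightarrow> bij_betw \<phi> (neighbourhood G u) (neighbourhood H (\<phi> u))"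
    and r: "r \<in> pverts G"
    and conn: "\<And>v. v \<in> pverts G \<Longrightarrow> r \<rightarrow>\<^sup>*\<^bsub>with_proj G\<^esub> v"
  shows "covering_map G (component H (\<phi> r)) \<phi>"
proof -
  define S where "S = {w. \<phi> r \<rightarrow>\<^sup>*\<^bsub>with_proj H\<^esub> w}"
  have comp: "component H (\<phi> r) = \<lparr>pverts = S, parcs = parcs H \<inter> S \<times> S\<rparr>"
    by (simp add: component_def S_def Let_def)
  have S_closed: "w \<in> S" if "v \<in> S" "(v, w) \<in> parcs H" for v w
    using that reachable_step_pair[OF wfH] by (simp add: S_def)
  have arc: "(\<phi> u, \<phi> v) \<in> parcs H" if "(u, v) \<in> parcs G" for u v
    using hom that by (simp add: graph_hom_def)
  have into: "\<phi> v \<in> S" if "v \<in> pverts G" for v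
    using conn[OF that, unfolded reachable_def]
  proof (induction rule: rtrancl_on_induct)
    case base
    have "\<phi> r \<in> pverts H" using hom r by (auto simp: graph_hom_def)
    then show ?case by (simp add: S_def reachable_refl_pair)
  next
    case (step x y)
    then have "(x, y) \<in> parcs G" by simp
    then show ?case using S_closed[OF step.IH arc] by blast
  qed
  have onto: "w \<in> \<phi> ` pverts G" if "w \<in> S" for w
    using that[unfolded S_def mem_Collect_eq reachable_def]
  proof (induction rule: rtrancl_on_induct)
    case base
    show ?case using r by simp
  next
    case (step x y)
    then obtain u where u: "u \<in> pverts G" "x = \<phi> u" by auto
    with step have "y \<in> neighbourhood H (\<phi> u)" by (simp add: neighbourhood_def)
    then obtain v where "(u, v) \<in> parcs G" "y = \<phi> v"
      using bij_betw_imp_surj_on[OF loc[OF u(1)]] by (auto simp: neighbourhood_def)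
    then show ?case using pair_wf_digraph_parcsD[OF wfG] by auto
  qed
  have "neighbourhood (component H (\<phi> r)) (\<phi> u) = neighbourhood H (\<phi> u)"
    if "u \<in> pverts G" for u
    using into[OF that] by (auto simp: comp neighbourhood_def intro: S_closed)
  moreover have "graph_hom G (component H (\<phi> r)) \<phi>"
    using into arc by (auto simp: graph_hom_def comp dest: pair_wf_digraph_parcsD[OF wfG])
  ultimately show ?thesis
    using loc into onto by (auto simp: covering_map_def comp)
qed

section \<open>Automorphisms of cores and of orbital graphs\<close>

text \<open>
  An injective map of the finite arc set into itself is onto, so a bijective endomorphism also
  reflects adjacency.
\<close>

lemma bij_endomorphism_automorphism:
  assumes wf: "pair_wf_digraph G" and fin: "finite (pverts G)"
    and hom: "graph_hom G G f" and bij: "bij_betw f (pverts G) (pverts G)"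
  shows "f \<in> automorphisms G"
proof -
  have sub: "parcs G \<subseteq> pverts G \<times> pverts G"
    by (auto dest: pair_wf_digraph_parcsD[OF wf])
  have inj: "inj_on f (pverts G)"
    using bij by (simp add: bij_betw_def)
  have "finite (parcs G)"
    using sub fin by (auto intro: finite_subset)
  moreover have "inj_on (map_prod f f) (parcs G)"
    using map_prod_inj_on[OF inj inj] sub by (rule inj_on_subset)
  moreover have "map_prod f f ` parcs G \<subseteq> parcs G"
    using hom by (auto simp: graph_hom_def)
  ultimately have surj: "map_prod f f ` parcs G = parcs G"
    by (metis endo_inj_surj)
  have "(u, v) \<in> parcs G" if "u \<in> pverts G" "v \<in> pverts G" and fuv: "(f u, f v) \<in> parcs G" for u v
  proof -
    from fuv obtain x y where xy: "(x, y) \<in> parcs G" "f u = f x" "f v = f y"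
      using surj by (auto elim!: equalityE)
    then have "x \<in> pverts G" "y \<in> pverts G"
      using sub by auto
    then show ?thesis
      using xy that inj by (auto dest: inj_onD)
  qed
  then show ?thesis
    using hom bij by (auto simp: automorphisms_iff[OF wf] graph_hom_def)
qed

text \<open>Being a core is transported along isomorphisms by conjugating endomorphisms.\<close>

lemma bij_endomorphism_if_iso_core:
  assumes core: "is_core K" and iso: "digraph_iso (with_proj G) (with_proj K)"
    and f: "graph_hom G G f"
  shows "bij_betw f (pverts G) (pverts G)"
proof -
  obtain i where i: "pre_digraph.digraph_isomorphism (with_proj G) i"
    and K: "with_proj K = app_iso i (with_proj G)"
    using iso by (auto simp: digraph_iso_def)
  define h where "h = iso_verts i"
  have "wf_digraph (with_proj G)"
    using i by (simp add: pre_digraph.digraph_isomorphism_def)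
  then have wf: "u \<in> pverts G" "v \<in> pverts G" if "(u, v) \<in> parcs G" for u v
    using that wf_digraph.tail_in_verts[of "with_proj G" "(u, v)"]
      wf_digraph.head_in_verts[of "with_proj G" "(u, v)"] by auto
  from K have V: "pverts K = h ` pverts G" and E: "parcs K = iso_arcs i ` parcs G"
    and tl: "iso_tail i = fst" and hd: "iso_head i = snd"
    by (auto simp: app_iso_def with_proj_def h_def)
  from i have inj: "inj_on h (pverts G)"
    and ends: "\<And>e. e \<in> parcs G \<Longrightarrow> iso_arcs i e = (h (fst e), h (snd e))"
    by (auto simp: pre_digraph.digraph_isomorphism_def h_def tl hd prod_eq_iff)
  have arcs: "parcs K = (\<lambda>(u, v). (h u, h v)) ` parcs G"
    unfolding E using ends by (auto simp: image_iff split_beta)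
  have bij_h: "bij_betw h (pverts G) (pverts K)"
    using inj V by (simp add: bij_betw_def)
  define k where "k = the_inv_into (pverts G) h"
  have k: "k (h u) = u" if "u \<in> pverts G" for u
    using that inj by (simp add: k_def the_inv_into_f_f)
  have f_in: "f u \<in> pverts G" if "u \<in> pverts G" for u
    using f that by (auto simp: graph_hom_def)
  have "graph_hom K K (h \<circ> f \<circ> k)"
    unfolding graph_hom_def
  proof (intro conjI allI impI)
    show "h \<circ> f \<circ> k \<in> pverts K \<rightarrow> pverts K"
      using f_in k by (auto simp: V)
    fix x y assume "(x, y) \<in> parcs K"
    then obtain u v where uv: "(u, v) \<in> parcs G" "x = h u" "y = h v"
      by (auto simp: arcs)
    moreover have "(f u, f v) \<in> parcs G"
      using f uv(1) by (simp add: graph_hom_def)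
    ultimately show "((h \<circ> f \<circ> k) x, (h \<circ> f \<circ> k) y) \<in> parcs K"
      using wf[OF uv(1)] by (auto simp: arcs k intro: rev_image_eqI)
  qed
  then have "bij_betw (h \<circ> f \<circ> k) (pverts K) (pverts K)"
    using core by (simp add: is_core_def)
  then have "bij_betw (h \<circ> f \<circ> k \<circ> h) (pverts G) (pverts K)"
    using bij_h by (rule bij_betw_trans[rotated])
  then have "bij_betw (h \<circ> f) (pverts G) (pverts K)"
    by (rule bij_betw_cong[THEN iffD1, rotated]) (simp add: k)
  \<comment> \<open>Cancelling the bijection \<open>h\<close> on the left needs only that \<open>f\<close> maps into its domain.\<close>
  then show ?thesis
    using bij_betw_comp_iff2[OF bij_h, of f "pverts G"] f_in by (auto simp: image_subset_iff)
qed

lemma orbital_graph_wf: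
  assumes wf: "pair_wf_digraph G" and orb: "orbital_graph G X"
  shows "pair_wf_digraph X"
proof (rule pair_wf_digraphI)
  have "g u \<in> pverts G" if "g \<in> automorphisms G" "u \<in> pverts G" for g u
    using that by (auto simp: automorphisms_iff[OF wf] dest: bij_betwE)
  then have "R \<subseteq> pverts G \<times> pverts G" if "R \<in> orbitals G" for R
    using that by (fastforce simp: orbitals_def)
  moreover obtain \<O> where "\<O> \<subseteq> orbitals G" "parcs X = \<Union>\<O>"
    using orb by (auto simp: orbital_graph_def)
  moreover have "pverts X = pverts G"
    using orb by (simp add: orbital_graph_def)
  ultimately show "parcs X \<subseteq> pverts X \<times> pverts X"
    by (auto simp: subset_iff)
qed

text \<open>
  Orbitals are the orbits of \<open>Aut G\<close> on pairs, so an automorphism of \<open>G\<close> is an endomorphism of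
  every orbital graph; finiteness upgrades it to an automorphism.
\<close>

lemma automorphism_orbital_graph:
  assumes wf: "pair_wf_digraph G" and fin: "finite (pverts G)"
    and orb: "orbital_graph G X" and g: "g \<in> automorphisms G"
  shows "g \<in> automorphisms X"
proof (rule bij_endomorphism_automorphism[OF orbital_graph_wf[OF wf orb]])
  have V: "pverts X = pverts G"
    using orb by (simp add: orbital_graph_def)
  show "finite (pverts X)"
    using fin V by simp
  show bij: "bij_betw g (pverts X) (pverts X)"
    using g V by (simp add: automorphisms_iff[OF wf])
  have "(g u, g v) \<in> parcs X" if uv: "(u, v) \<in> parcs X" for u v
  proof -
    obtain \<O> where \<O>: "\<O> \<subseteq> orbitals G" "parcs X = \<Union>\<O>"
      using orb by (auto simp: orbital_graph_def)
    with uv obtain R where R: "(u, v) \<in> R" "R \<in> \<O>"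
      by auto
    with \<O> obtain x y where xy: "x \<in> pverts G" "y \<in> pverts G"
      and R_def: "R = {(h x, h y) | h. h \<in> automorphisms G}"
      by (auto simp: orbitals_def)
    with R obtain h where h: "h \<in> automorphisms G" "u = h x" "v = h y"
      by auto
    have "g \<circ> h \<in> automorphisms G"
      using g h(1) by (auto simp: automorphisms_iff[OF wf] intro: bij_betw_trans dest: bij_betwE)
    then have "(g u, g v) \<in> R"
      unfolding R_def h(2,3) by (auto intro!: exI[of _ "g \<circ> h"])
    then show ?thesis
      using R \<O> by auto
  qed
  then show "graph_hom X X g"
    using bij by (auto simp: graph_hom_def dest: bij_betwE)
qed

lemma automorphism_neighbourhood:
  assumes wf: "pair_wf_digraph G" and g: "g \<in> automorphisms G" and u: "u \<in> pverts G"
  shows "bij_betw g (neighbourhood G u) (neighbourhood G (g u))"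
proof (rule bij_betw_imageI)
  have sub: "neighbourhood G w \<subseteq> pverts G" for w
    by (auto simp: neighbourhood_def dest: pair_wf_digraph_parcsD[OF wf])
  have bij: "bij_betw g (pverts G) (pverts G)"
    and iff: "\<And>v. v \<in> pverts G \<Longrightarrow> (g u, g v) \<in> parcs G \<longleftrightarrow> (u, v) \<in> parcs G"
    using g u by (auto simp: automorphisms_iff[OF wf])
  show "inj_on g (neighbourhood G u)"
    using bij sub by (auto simp: bij_betw_def intro: inj_on_subset)
  show "g ` neighbourhood G u = neighbourhood G (g u)"
  proof
    show "g ` neighbourhood G u \<subseteq> neighbourhood G (g u)"
      using sub[of u] iff by (auto simp: neighbourhood_def)
    show "neighbourhood G (g u) \<subseteq> g ` neighbourhood G u"
    proof
      fix w assume w: "w \<in> neighbourhood G (g u)"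
      then have "w \<in> pverts G"
        using sub by auto
      then obtain v where "v \<in> pverts G" "w = g v"
        using bij_betw_imp_surj_on[OF bij] by auto
      then show "w \<in> g ` neighbourhood G u"
        using w iff by (auto simp: neighbourhood_def)
    qed
  qed
qed

section \<open>Cayley graphs for elementary abelian 2-groups\<close>

locale elementary_abelian_2_group = comm_group +
  assumes square: "x \<in> carrier G \<Longrightarrow> x \<otimes> x = \<one>"
begin

lemma mult_left_involution:
  "x \<in> carrier G \<Longrightarrow> y \<in> carrier G \<Longrightarrow> x \<otimes> (x \<otimes> y) = y"
  by (simp add: m_assoc[symmetric] square)

lemma pair_wf_digraph_Cay: "pair_wf_digraph (Cay G C)"
  by (rule pair_wf_digraphI) (auto simp: Cay_def)

lemma Cay_arc_translate:
  assumes "(x, y) \<in> parcs (Cay G C)" and "u \<in> carrier G"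
  shows "(u \<otimes> x, u \<otimes> y) \<in> parcs (Cay G C)"
proof -
  have "x \<in> carrier G" "y \<in> carrier G"
    using assms by (auto simp: Cay_def)
  then have "(u \<otimes> x) \<otimes> (u \<otimes> y) = x \<otimes> y"
    using assms(2) by (simp add: m_ac mult_left_involution)
  then show ?thesis
    using assms by (auto simp: Cay_def)
qed

lemma bij_betw_neighbourhood_Cay:
  assumes C: "C \<subseteq> carrier G" and u: "u \<in> carrier G"
  shows "bij_betw (\<lambda>c. u \<otimes> c) C (neighbourhood (Cay G C) u)"
proof (rule bij_betw_byWitness[where f' = "\<lambda>v. u \<otimes> v"])
  show "\<forall>c\<in>C. u \<otimes> (u \<otimes> c) = c"
    using C u mult_left_involution by auto
  show "\<forall>v\<in>neighbourhood (Cay G C) u. u \<otimes> (u \<otimes> v) = v"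
    using u mult_left_involution by (auto simp: neighbourhood_def Cay_def)
  show "(\<lambda>c. u \<otimes> c) ` C \<subseteq> neighbourhood (Cay G C) u"
    using C u mult_left_involution by (auto simp: neighbourhood_def Cay_def)
  show "(\<lambda>v. u \<otimes> v) ` neighbourhood (Cay G C) u \<subseteq> C"
    by (auto simp: neighbourhood_def Cay_def)
qed

lemma elementary_abelian_2_group_subgroup_generated:
  "elementary_abelian_2_group (subgroup_generated G S)"
proof -
  interpret H: comm_group "subgroup_generated G S"
    by (rule abelian_subgroup_generated) unfold_locales
  show ?thesis
    using carrier_subgroup_generated_subset[of S] square by unfold_locales auto
qed

text \<open>
  Reachability is invariant under translations, which suggests proving that \<open>u + v\<close> is reachable from
  every \<open>u\<close>; that form is closed under products of generators. Inverses of generators add nothing,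
  since every element is its own inverse.
\<close>

lemma reachable_Cay_generate:
  assumes S: "S \<subseteq> carrier G" and v: "v \<in> generate G S"
  shows "\<one> \<rightarrow>\<^sup>*\<^bsub>with_proj (Cay (subgroup_generated G S) S)\<^esub> v"
proof -
  define Y where "Y = Cay (subgroup_generated G S) S"
  interpret H: elementary_abelian_2_group "subgroup_generated G S"
    by (rule elementary_abelian_2_group_subgroup_generated)
  have wf: "pair_wf_digraph Y"
    unfolding Y_def by (rule H.pair_wf_digraph_Cay)
  have V: "pverts Y = generate G S"
    using S by (simp add: Y_def Cay_def carrier_subgroup_generated Int_absorb1)
  have sub: "generate G S \<subseteq> carrier G"
    using S by (rule generate_incl)
  have step: "u \<rightarrow>\<^sup>*\<^bsub>with_proj Y\<^esub> (u \<otimes> s)" if u: "u \<in> generate G S" and s: "s \<in> S" for u s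
  proof -
    have "u \<otimes> s \<in> generate G S"
      using u s by (simp add: generate.eng generate.incl)
    moreover have "u \<otimes> (u \<otimes> s) = s"
      using u s S sub by (intro mult_left_involution) (simp_all add: subset_iff)
    ultimately have "(u, u \<otimes> s) \<in> parcs Y"
      using u s S by (simp add: Y_def Cay_def carrier_subgroup_generated Int_absorb1)
    then show ?thesis
      using u V by (intro reachable_step_pair[OF wf reachable_refl_pair]) simp_all
  qed
  have "u \<rightarrow>\<^sup>*\<^bsub>with_proj Y\<^esub> (u \<otimes> v)" if "u \<in> generate G S" for u
    using v that
  proof (induction arbitrary: u rule: generate.induct)
    case one
    then show ?case
      using sub V by (simp add: subset_iff reachable_refl_pair)
  next
    case (incl h)
    then show ?case
      using step by simp
  next
    case (inv h)
    then have "inv h = h"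
      using S square by (intro inv_equality) (simp_all add: subset_iff)
    then show ?case
      using step inv by simp
  next
    case (eng h1 h2)
    have "u \<rightarrow>\<^sup>*\<^bsub>with_proj Y\<^esub> (u \<otimes> h1)"
      using eng by simp
    moreover have "(u \<otimes> h1) \<rightarrow>\<^sup>*\<^bsub>with_proj Y\<^esub> (u \<otimes> h1 \<otimes> h2)"
      using eng by (simp add: generate.eng)
    ultimately have "u \<rightarrow>\<^sup>*\<^bsub>with_proj Y\<^esub> (u \<otimes> h1 \<otimes> h2)"
      unfolding reachable_def by (rule rtrancl_on_trans)
    moreover have "u \<otimes> h1 \<otimes> h2 = u \<otimes> (h1 \<otimes> h2)"
      using eng sub by (intro m_assoc) (simp_all add: subset_iff)
    ultimately show ?case
      by simp
  qed
  from this[of \<one>] show ?thesis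
    using v sub by (simp add: Y_def generate.one subset_iff)
qed

end

text \<open>
  A homomorphism turns the translate \<open>u + C\<close> of the connection set into \<open>h u + h C\<close>, so it is as
  injective on neighbourhoods as it is on the connection set.
\<close>

lemma covering_map_hom_Cay:
  assumes "elementary_abelian_2_group G" and "elementary_abelian_2_group H"
    and h: "h \<in> hom G H" and surj: "h ` carrier G = carrier H"
    and C: "C \<subseteq> carrier G" and bij: "bij_betw h C D"
  shows "covering_map (Cay G C) (Cay H D) h"
proof -
  interpret G: elementary_abelian_2_group G by fact
  interpret H: elementary_abelian_2_group H by fact
  have h_closed: "h x \<in> carrier H" if "x \<in> carrier G" for x
    using h that by (auto simp: hom_def)
  have h_mult: "h (x \<otimes>\<^bsub>G\<^esub> y) = h x \<otimes>\<^bsub>H\<^esub> h y" if "x \<in> carrier G" "y \<in> carrier G" for x y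
    using h that by (auto simp: hom_def)
  have D: "D = h ` C"
    using bij by (simp add: bij_betw_def)
  have "graph_hom (Cay G C) (Cay H D) h"
    using h_closed by (auto simp: graph_hom_def Cay_def D h_mult[symmetric])
  moreover have "bij_betw h (neighbourhood (Cay G C) u) (neighbourhood (Cay H D) (h u))"
    if u: "u \<in> carrier G" for u
  proof -
    have "bij_betw (\<lambda>d. h u \<otimes>\<^bsub>H\<^esub> d) D (neighbourhood (Cay H D) (h u))"
      using C D h_closed u by (intro H.bij_betw_neighbourhood_Cay) auto
    with bij have "bij_betw ((\<lambda>d. h u \<otimes>\<^bsub>H\<^esub> d) \<circ> h) C (neighbourhood (Cay H D) (h u))"
      by (rule bij_betw_trans)
    then have "bij_betw (h \<circ> (\<lambda>c. u \<otimes>\<^bsub>G\<^esub> c)) C (neighbourhood (Cay H D) (h u))"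
      by (rule bij_betw_cong[THEN iffD1, rotated]) (use C u h_mult in auto)
    then show ?thesis
      using bij_betw_comp_iff[OF G.bij_betw_neighbourhood_Cay[OF C u]] by blast
  qed
  ultimately show ?thesis
    using surj by (auto simp: covering_map_def) (auto simp: Cay_def)
qed

section \<open>Covering by the cube\<close>

lemma elementary_abelian_2_group_Z2pow: "elementary_abelian_2_group (Z2pow n)"
proof -
  interpret comm_group "Z2pow n" by (rule comm_group_Z2pow)
  show ?thesis
    by unfold_locales (rule Z2pow_square)
qed

lemma Z2pow_coord:
  "x \<in> carrier (Z2pow d) \<Longrightarrow> i < d \<Longrightarrow> x i = 0 \<or> x i = 1"
  by (auto simp: Z2pow_def carrier_integer_mod_group PiE_iff) force

lemma unit_vec_carrier: "unit_vec d i \<in> carrier (Z2pow d)"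
  by (auto simp: unit_vec_def Z2pow_def carrier_integer_mod_group)

lemma unit_vec_inj: "inj_on (unit_vec d) {..<d}"
  by (rule inj_onI) (auto simp: unit_vec_def fun_eq_iff restrict_def split: if_splits)

context elementary_abelian_2_group
begin

text \<open>The \<open>\<int>\<^sub>2\<close>-linear combination of the vectors \<open>a\<^sub>i\<close> with coefficient vector \<open>x\<close>.\<close>

definition lincomb :: "nat \<Rightarrow> (nat \<Rightarrow> 'a) \<Rightarrow> (nat \<Rightarrow> int) \<Rightarrow> 'a" where
  "lincomb d a x = finprod G (\<lambda>i. if x i = 1 then a i else \<one>) {..<d}"

lemma lincomb_hom:
  assumes a: "\<And>i. i < d \<Longrightarrow> a i \<in> carrier G"
  shows "lincomb d a \<in> hom (Z2pow d) G"
proof (rule homI)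
  fix x y assume x: "x \<in> carrier (Z2pow d)" and y: "y \<in> carrier (Z2pow d)"
  show "lincomb d a x \<in> carrier G"
    using a by (auto simp: lincomb_def)
  have "(if (x \<otimes>\<^bsub>Z2pow d\<^esub> y) i = 1 then a i else \<one>)
      = (if x i = 1 then a i else \<one>) \<otimes> (if y i = 1 then a i else \<one>)" if i: "i < d" for i
    using Z2pow_coord[OF x i] Z2pow_coord[OF y i] a[OF i] i by (auto simp: Z2pow_def square)
  then have "lincomb d a (x \<otimes>\<^bsub>Z2pow d\<^esub> y)
      = finprod G (\<lambda>i. (if x i = 1 then a i else \<one>) \<otimes> (if y i = 1 then a i else \<one>)) {..<d}"
    unfolding lincomb_def using a by (intro finprod_cong') auto
  also have "\<dots> = lincomb d a x \<otimes> lincomb d a y"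
    unfolding lincomb_def using a by (intro finprod_multf) auto
  finally show "lincomb d a (x \<otimes>\<^bsub>Z2pow d\<^esub> y) = lincomb d a x \<otimes> lincomb d a y" .
qed

lemma lincomb_unit_vec:
  assumes "\<And>i. i < d \<Longrightarrow> a i \<in> carrier G" and "i < d"
  shows "lincomb d a (unit_vec d i) = a i"
proof -
  have "lincomb d a (unit_vec d i) = finprod G (\<lambda>j. if i = j then a j else \<one>) {..<d}"
    unfolding lincomb_def using assms by (intro finprod_cong') (auto simp: unit_vec_def)
  also have "\<dots> = a i"
    using assms by (intro finprod_singleton) auto
  finally show ?thesis .
qed

lemma cube_covers_Cay:
  assumes a: "\<And>i. i < d \<Longrightarrow> a i \<in> carrier G" and inj: "inj_on a {..<d}"
    and gen: "carrier G = generate G (a ` {..<d})"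
  shows "covering_map (cube d) (Cay G (a ` {..<d})) (lincomb d a)"
  unfolding cube_def
proof (rule covering_map_hom_Cay[OF elementary_abelian_2_group_Z2pow])
  show "elementary_abelian_2_group G" by unfold_locales
  show hom: "lincomb d a \<in> hom (Z2pow d) G"
    using a by (rule lincomb_hom)
  show "unit_vec d ` {..<d} \<subseteq> carrier (Z2pow d)"
    using unit_vec_carrier by auto
  have "bij_betw (lincomb d a \<circ> unit_vec d) {..<d} (a ` {..<d})"
    using inj_on_imp_bij_betw[OF inj]
    by (rule bij_betw_cong[THEN iffD1, rotated]) (simp add: lincomb_unit_vec a)
  then show "bij_betw (lincomb d a) (unit_vec d ` {..<d}) (a ` {..<d})"
    by (simp only: bij_betw_comp_iff[OF inj_on_imp_bij_betw[OF unit_vec_inj]])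
  interpret Z: comm_group "Z2pow d"
    by (rule comm_group_Z2pow)
  interpret L: group_hom "Z2pow d" G "lincomb d a"
    using hom by unfold_locales
  have "a ` {..<d} \<subseteq> lincomb d a ` carrier (Z2pow d)"
  proof
    fix y assume "y \<in> a ` {..<d}"
    then obtain i where "i < d" "y = a i" by auto
    then have "y = lincomb d a (unit_vec d i)"
      by (simp add: lincomb_unit_vec a)
    then show "y \<in> lincomb d a ` carrier (Z2pow d)"
      using unit_vec_carrier by (rule image_eqI)
  qed
  then have "generate G (a ` {..<d}) \<subseteq> lincomb d a ` carrier (Z2pow d)"
    using L.img_is_subgroup by (rule generate_subgroup_incl)
  then show "lincomb d a ` carrier (Z2pow d) = carrier G"
    using L.hom_closed by (auto simp: gen[symmetric])
qed

end

section \<open>Retractions of Cayley graphs onto their cores\<close>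

lemma retraction_onto_subgraph:
  assumes "retraction_onto Z M \<rho>"
  shows "pverts M \<subseteq> pverts Z" and "pair_wf_digraph M"
  using assms by (auto simp: retraction_onto_def induced_subgraph_def subgraph_def
      intro!: pair_wf_digraphI dest: wf_digraph.tail_in_verts wf_digraph.head_in_verts)

text \<open>
  Inducedness of the retract is what makes this an endomorphism: the retraction is only known to
  preserve the arcs of the ambient Cayley graph. The core hypothesis then turns it into an
  automorphism.
\<close>

lemma (in elementary_abelian_2_group) retract_translate_automorphism:
  assumes ret: "retraction_onto (Cay G C) M \<rho>" and fin: "finite (carrier G)"
    and core: "\<And>f. graph_hom M M f \<Longrightarrow> bij_betw f (pverts M) (pverts M)"
    and u: "u \<in> carrier G"
  shows "(\<lambda>x. \<rho> (u \<otimes> x)) \<in> automorphisms M"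
proof -
  define Z where "Z = Cay G C"
  have VZ: "pverts Z = carrier G"
    by (simp add: Z_def Cay_def)
  have ind: "induced_subgraph (with_proj M) (with_proj Z)" and hom: "graph_hom Z Z \<rho>"
    and img: "\<rho> ` carrier G = pverts M"
    using ret VZ by (auto simp: retraction_onto_def Z_def)
  have sub: "pverts M \<subseteq> carrier G"
    and arcs: "parcs M = {e \<in> parcs Z. fst e \<in> pverts M \<and> snd e \<in> pverts M}"
    using ind by (auto simp: induced_subgraph_def subgraph_def VZ)
  have "graph_hom M M (\<lambda>x. \<rho> (u \<otimes> x))"
    unfolding graph_hom_def
  proof (intro conjI allI impI)
    show into: "(\<lambda>x. \<rho> (u \<otimes> x)) \<in> pverts M \<rightarrow> pverts M"
      using img sub u by auto
    fix x y assume xy: "(x, y) \<in> parcs M"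
    then have "(u \<otimes> x, u \<otimes> y) \<in> parcs Z"
      using arcs u by (auto simp: Z_def intro: Cay_arc_translate)
    then show "(\<rho> (u \<otimes> x), \<rho> (u \<otimes> y)) \<in> parcs M"
      using hom into xy arcs by (auto simp: graph_hom_def)
  qed
  then show ?thesis
    using arcs sub fin core
    by (intro bij_endomorphism_automorphism) (auto intro: pair_wf_digraphI finite_subset)
qed

text \<open>
  The automorphism \<open>x \<mapsto> \<rho> (u + x)\<close> of \<open>X\<close> carries the neighbours of \<open>0\<close> to those of \<open>\<rho> u\<close>, while
  translation by \<open>u\<close> carries them to the neighbours of \<open>u\<close> in the Cayley graph. Hence \<open>\<rho>\<close> is
  bijective between the last two sets.
\<close>

lemma (in elementary_abelian_2_group) retraction_covers_component:
  assumes ret: "retraction_onto (Cay G C) M \<rho>" and fin: "finite (carrier G)"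
    and core: "\<And>f. graph_hom M M f \<Longrightarrow> bij_betw f (pverts M) (pverts M)"
    and one: "\<one> \<in> pverts M" and orb: "orbital_graph M X"
    and S: "S = neighbourhood X \<one>"
  shows "covering_map (Cay (subgroup_generated G S) S) (component X \<one>) \<rho>"
proof -
  define Y where "Y = Cay (subgroup_generated G S) S"
  interpret H: elementary_abelian_2_group "subgroup_generated G S"
    by (rule elementary_abelian_2_group_subgroup_generated)
  have VM: "pverts M \<subseteq> carrier G" and wfM: "pair_wf_digraph M"
    using retraction_onto_subgraph[OF ret] by (simp_all add: Cay_def)
  have finM: "finite (pverts M)"
    using VM fin by (rule finite_subset)
  have VX: "pverts X = pverts M"
    using orb by (simp add: orbital_graph_def)
  have wfX: "pair_wf_digraph X"
    using wfM orb by (rule orbital_graph_wf)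
  have wfY: "pair_wf_digraph Y"
    unfolding Y_def by (rule H.pair_wf_digraph_Cay)
  have S_sub: "S \<subseteq> carrier G"
    using S VX VM by (auto simp: neighbourhood_def dest: pair_wf_digraph_parcsD[OF wfX])
  have VY: "pverts Y = generate G S"
    using S_sub by (simp add: Y_def Cay_def carrier_subgroup_generated Int_absorb1)
  have VY_sub: "pverts Y \<subseteq> carrier G"
    using VY S_sub generate_incl by simp
  have rho_one: "\<rho> \<one> = \<one>"
    using ret one by (simp add: retraction_onto_def)
  have loc: "bij_betw \<rho> (neighbourhood Y u) (neighbourhood X (\<rho> u))" if uY: "u \<in> pverts Y" for u
  proof -
    have u: "u \<in> carrier G"
      using uY VY_sub by auto
    have "(\<lambda>x. \<rho> (u \<otimes> x)) \<in> automorphisms X"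
      using ret fin core u by (intro automorphism_orbital_graph[OF wfM finM orb]
          retract_translate_automorphism)
    then have "bij_betw (\<lambda>x. \<rho> (u \<otimes> x)) S (neighbourhood X (\<rho> u))"
      using automorphism_neighbourhood[OF wfX, of "\<lambda>x. \<rho> (u \<otimes> x)" \<one>] one VX S u by simp
    then have "bij_betw (\<rho> \<circ> (\<lambda>x. u \<otimes> x)) S (neighbourhood X (\<rho> u))"
      by (simp add: comp_def)
    moreover have "bij_betw (\<lambda>x. u \<otimes> x) S (neighbourhood Y u)"
      using H.bij_betw_neighbourhood_Cay[of S u] uY subgroup_generated_subset_carrier_subset[OF S_sub]
      by (simp add: Y_def Cay_def)
    ultimately show ?thesis
      using bij_betw_comp_iff by blast
  qed
  have "graph_hom Y X \<rho>"
    unfolding graph_hom_def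
  proof (intro conjI allI impI)
    show "\<rho> \<in> pverts Y \<rightarrow> pverts X"
      using ret VY_sub VX by (auto simp: retraction_onto_def Cay_def)
    fix u v assume uv: "(u, v) \<in> parcs Y"
    then show "(\<rho> u, \<rho> v) \<in> parcs X"
      using bij_betwE[OF loc] pair_wf_digraph_parcsD[OF wfY uv] by (auto simp: neighbourhood_def)
  qed
  then have "covering_map Y (component X (\<rho> \<one>)) \<rho>"
    using reachable_Cay_generate[OF S_sub] VY
    by (intro covering_map_component[OF wfY wfX]) (auto simp: loc Y_def[symmetric] generate.one)
  then show ?thesis
    by (simp add: rho_one Y_def)
qed

theorem theorem7p2:
  fixes n d :: nat
    and C :: "(nat \<Rightarrow> int) set"
    and Z Xcore X Y :: "(nat \<Rightarrow> int) pair_pre_digraph"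
    and K :: "'k pair_pre_digraph"
    and \<rho> :: "(nat \<Rightarrow> int) \<Rightarrow> (nat \<Rightarrow> int)"
    and a :: "nat \<Rightarrow> (nat \<Rightarrow> int)"
  assumes "C \<subseteq> carrier (Z2pow n) - {\<one>\<^bsub>Z2pow n\<^esub>}"
    and "Z = Cay (Z2pow n) C"
    and "retraction_onto Z Xcore \<rho>"
    and "core_of K Z" and "digraph_iso (with_proj Xcore) (with_proj K)"
    and "\<one>\<^bsub>Z2pow n\<^esub> \<in> pverts Xcore"
    and "orbital_graph Xcore X"
    and "bij_betw a {..<d} (neighbourhood X \<one>\<^bsub>Z2pow n\<^esub>)"
    and "Y = Cay (subgroup_generated (Z2pow n) (a ` {..<d})) (a ` {..<d})"
  shows "covering_map Y (component X \<one>\<^bsub>Z2pow n\<^esub>) (restrict \<rho> (pverts Y)) \<and>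
         (\<exists>\<phi>. covering_map (cube d) (component X \<one>\<^bsub>Z2pow n\<^esub>) \<phi>)"
proof -
  interpret \<Gamma>: elementary_abelian_2_group "Z2pow n"
    by (rule elementary_abelian_2_group_Z2pow)
  define H where "H = subgroup_generated (Z2pow n) (a ` {..<d})"
  interpret H: elementary_abelian_2_group H
    unfolding H_def by (rule \<Gamma>.elementary_abelian_2_group_subgroup_generated)
  have S: "a ` {..<d} = neighbourhood X \<one>\<^bsub>Z2pow n\<^esub>" and inj: "inj_on a {..<d}"
    using assms(8) by (auto simp: bij_betw_def)
  have core: "bij_betw f (pverts Xcore) (pverts Xcore)" if "graph_hom Xcore Xcore f" for f
    using assms(4,5) that by (auto simp: core_of_def intro: bij_endomorphism_if_iso_core)
  have cov: "covering_map Y (component X \<one>\<^bsub>Z2pow n\<^esub>) \<rho>"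
    using assms(3,6,7) core finite_Z2pow S unfolding assms(2) assms(9)
    by (intro \<Gamma>.retraction_covers_component)
  have wf: "pair_wf_digraph Y"
    unfolding assms(9) H_def[symmetric] by (rule H.pair_wf_digraph_Cay)
  have "pair_wf_digraph X"
    using retraction_onto_subgraph(2)[OF assms(3)] assms(7) by (rule orbital_graph_wf)
  then have "a ` {..<d} \<subseteq> pverts Xcore"
    using assms(7) S by (auto simp: neighbourhood_def orbital_graph_def dest: pair_wf_digraph_parcsD)
  then have S_sub: "a ` {..<d} \<subseteq> carrier (Z2pow n)"
    using retraction_onto_subgraph(1)[OF assms(3)] by (auto simp: assms(2) Cay_def)
  have "carrier H = generate H (a ` {..<d})"
    using \<Gamma>.subgroup_generated2[of "a ` {..<d}"]
      \<Gamma>.subgroup_generated_subset_carrier_subset[OF S_sub]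
    unfolding H_def[symmetric] by (metis carrier_subgroup_generated inf.absorb2)
  then have "covering_map (cube d) Y (H.lincomb d a)"
    using H.cube_covers_Cay[of d a] inj \<Gamma>.subgroup_generated_subset_carrier_subset[OF S_sub]
    unfolding assms(9) H_def[symmetric] by auto
  then show ?thesis
    using covering_map_restrict[OF wf cov] covering_map_compose[OF _ cov] by blast
qed

end
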